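(* Let $n\ge 1$ be an integer and let $k\ge 3$ be an odd integer. Let $P_{2n+1}$ be the path with vertices $v_1,\ldots,v_{2n+1}$ in the natural order, let $U=\{v_{2i+1}: 0\le i\le n\}$, let $C_k$ be the cycle on $k$ vertices, and let $\Gamma_{n,k}=P_{2n+1}(U)\sqcap C_k$. Then $\dim_{\ell}(\Gamma_{n,k})=2$.
   Context: $d_G(u,v)$ denotes the shortest-path distance in a connected graph $G$. Local metric dimension: for $S=\{s_1,\ldots,s_m\}\subseteq V(G)$, the metric $S$-representation of $v\in V(G)$ is the vector $r_G(v|S)=(d_G(v,s_1),\ldots,d_G(v,s_m))$. The set $S$ is a local metric generator for $G$ if every two adjacent vertices of $G$ have different metric $S$-representations. The local metric dimension $\dim_{\ell}(G)$ is the smallest cardinality of a local metric generator for $G$. Generalized hierarchical product: for graphs $G,H$ and $\emptyset\ne U\subseteq V(G)$, the graph $G(U)\sqcap H$ has vertex set $V(G)\times V(H)$ and edge set $$\{(g,h)(g',h'): gg'\in E(G),\ h=h'\}\cup\{(g,h)(g',h'): g=g'\in U,\ hh'\in E(H)\}.$$ *)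

theory Defs
  imports "Graph_Theory.Graph_Theory" "HOL-Library.FuncSet"
begin

text \<open>
  An undirected simple graph is a symmetric loop-free digraph whose arcs are ordered pairs
  (\<^locale>\<open>pair_graph\<close>): each edge is present in both directions.
\<close>

section \<open>Local metric dimension\<close>

text \<open>Number of arcs of a shortest walk; infinite if there is none.\<close>

definition graph_dist :: "('a, 'b) pre_digraph \<Rightarrow> 'a \<Rightarrow> 'a \<Rightarrow> ereal" where
  "graph_dist G u v = wf_digraph.\<mu> G (\<lambda>_. 1) u v"

text \<open>
  The vector of distances is indexed by the elements of \<open>S\<close> themselves, so that no enumeration of
  \<open>S\<close> has to be chosen.
\<close>

definition metric_repr :: "('a, 'b) pre_digraph \<Rightarrow> 'a set \<Rightarrow> 'a \<Rightarrow> 'a \<Rightarrow> ereal" where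
  "metric_repr G S v = (\<lambda>s\<in>S. graph_dist G v s)"

definition local_metric_generator :: "('a, 'b) pre_digraph \<Rightarrow> 'a set \<Rightarrow> bool" where
  "local_metric_generator G S \<longleftrightarrow>
     finite S \<and> S \<subseteq> verts G \<and>
     (\<forall>u v. u \<rightarrow>\<^bsub>G\<^esub> v \<longrightarrow> metric_repr G S u \<noteq> metric_repr G S v)"

text \<open>Meaningful for finite connected simple graphs, where \<open>verts G\<close> is always a generator.\<close>

definition local_metric_dim :: "('a, 'b) pre_digraph \<Rightarrow> nat" where
  "local_metric_dim G = (LEAST m. \<exists>S. local_metric_generator G S \<and> card S = m)"

section \<open>Paths, cycles and the generalized hierarchical product\<close>

definition path_graph :: "nat \<Rightarrow> nat pair_pre_digraph" where
  "path_graph m =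
     \<lparr> pverts = {1..m},
       parcs = {(i, j). i \<in> {1..m} \<and> j \<in> {1..m} \<and> (j = i + 1 \<or> i = j + 1)} \<rparr>"

text \<open>A simple graph for \<open>k \<ge> 2\<close>, and the cycle on \<open>k\<close> vertices for \<open>k \<ge> 3\<close>.\<close>

definition cycle_graph :: "nat \<Rightarrow> nat pair_pre_digraph" where
  "cycle_graph k =
     \<lparr> pverts = {0..<k},
       parcs = {(i, j). i < k \<and> j < k \<and> (j = (i + 1) mod k \<or> i = (j + 1) mod k)} \<rparr>"

definition hierarchical_product ::
  "'a pair_pre_digraph \<Rightarrow> 'a set \<Rightarrow> 'b pair_pre_digraph \<Rightarrow> ('a \<times> 'b) pair_pre_digraph" where
  "hierarchical_product G U H =
     \<lparr> pverts = pverts G \<times> pverts H,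
       parcs = {((g, h), (g', h')). (g, g') \<in> parcs G \<and> h = h' \<and> h \<in> pverts H}
             \<union> {((g, h), (g', h')). g = g' \<and> g \<in> U \<and> (h, h') \<in> parcs H} \<rparr>"

definition Gamma_graph :: "nat \<Rightarrow> nat \<Rightarrow> (nat \<times> nat) pair_pre_digraph" where
  "Gamma_graph n k =
     hierarchical_product (path_graph (2 * n + 1)) {2 * i + 1 |i. 0 \<le> i \<and> i \<le> n} (cycle_graph k)"

section \<open>The graphs involved are simple and connected\<close>

lemma pair_graphI:
  assumes fin: "finite (pverts G)"
    and wf: "\<And>u v. (u, v) \<in> parcs G \<Longrightarrow> u \<in> pverts G \<and> v \<in> pverts G"
    and irr: "\<And>u. (u, u) \<notin> parcs G"
    and sy: "\<And>u v. (u, v) \<in> parcs G \<Longrightarrow> (v, u) \<in> parcs G"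
  shows "pair_graph G"
proof unfold_locales
  have "parcs G \<subseteq> pverts G \<times> pverts G" using wf by auto
  then show "finite (parcs G)" using fin by (meson finite_SigmaI finite_subset)
  show "symmetric G" using sy by (auto simp: symmetric_def sym_def)
  show "fst e \<in> pverts G" "snd e \<in> pverts G" "fst e \<noteq> snd e" if "e \<in> parcs G" for e
    using that wf irr by (cases e, force)+
qed (fact fin)

lemma pair_graph_path_graph: "pair_graph (path_graph m)"
  by (rule pair_graphI) (auto simp: path_graph_def)

lemma pair_graph_cycle_graph:
  assumes "k \<ge> 2"
  shows "pair_graph (cycle_graph k)"
proof (rule pair_graphI)
  fix i
  show "(i, i) \<notin> parcs (cycle_graph k)"
    using assms by (cases "i + 1 = k") (auto simp: cycle_graph_def)
qed (auto simp: cycle_graph_def)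

lemma pair_graph_hierarchical_product:
  assumes G: "pair_graph G" and H: "pair_graph H" and "U \<subseteq> pverts G"
  shows "pair_graph (hierarchical_product G U H)"
proof -
  interpret G: pair_graph G by fact
  interpret H: pair_graph H by fact
  have "sym (parcs G)" "sym (parcs H)"
    using G.pair_sym_arcs H.pair_sym_arcs by (simp_all add: symmetric_def)
  then show ?thesis
    using assms(3)
    by (intro pair_graphI)
       (auto simp: hierarchical_product_def dest: G.in_arcsD1 G.in_arcsD2 H.in_arcsD1 H.in_arcsD2
          G.no_loops' H.no_loops' symD)
qed

lemma pair_graph_Gamma_graph:
  assumes "k \<ge> 2"
  shows "pair_graph (Gamma_graph n k)"
  unfolding Gamma_graph_def
  by (intro pair_graph_hierarchical_product pair_graph_path_graph pair_graph_cycle_graph assms)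
     (auto simp: path_graph_def)

lemma connected_Gamma_graph:
  assumes k: "k \<ge> 2"
  shows "connected (with_proj (Gamma_graph n k))"
proof -
  let ?G = "Gamma_graph n k"
  interpret pair_graph ?G by (rule pair_graph_Gamma_graph[OF k])
  have V: "(i, h) \<in> pverts ?G \<longleftrightarrow> 1 \<le> i \<and> i \<le> 2 * n + 1 \<and> h < k" for i h
    by (auto simp: Gamma_graph_def hierarchical_product_def path_graph_def cycle_graph_def)
  have down: "(1, h) \<rightarrow>\<^sup>*\<^bsub>with_proj ?G\<^esub> (Suc i, h)" if "i < 2 * n + 1" "h < k" for i h
    using that
  proof (induction i)
    case 0
    then show ?case using V[of 1 h] by (simp add: reachable_refl)
  next
    case (Suc i)
    have "((Suc i, h), (Suc (Suc i), h)) \<in> parcs ?G"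
      using Suc.prems
      by (auto simp: Gamma_graph_def hierarchical_product_def path_graph_def cycle_graph_def)
    then show ?case using Suc by (metis Suc_lessD reachable_adj_trans with_proj_simps(3))
  qed
  have across: "(1, 0) \<rightarrow>\<^sup>*\<^bsub>with_proj ?G\<^esub> (1, h)" if "h < k" for h
    using that
  proof (induction h)
    case 0
    then show ?case using V[of 1 0] by (simp add: reachable_refl)
  next
    case (Suc h)
    have "((1, h), (1, Suc h)) \<in> parcs ?G"
      using Suc.prems
      by (auto simp: Gamma_graph_def hierarchical_product_def path_graph_def cycle_graph_def)
    then show ?case using Suc by (metis Suc_lessD reachable_adj_trans with_proj_simps(3))
  qed
  have base: "(1, 0) \<rightarrow>\<^sup>*\<^bsub>with_proj ?G\<^esub> x" if "x \<in> pverts ?G" for x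
  proof -
    obtain i h where x: "x = (i, h)" by (cases x)
    with that V have "1 \<le> i" "i \<le> 2 * n + 1" "h < k" by auto
    then show ?thesis
      using down[of "i - 1" h] across[of h] x by (auto intro: reachable_trans)
  qed
  have "strongly_connected (with_proj ?G)"
  proof (rule strongly_connectedI)
    show "verts (with_proj ?G) \<noteq> {}" using V[of 1 0] k by auto
    fix u v assume "u \<in> verts (with_proj ?G)" "v \<in> verts (with_proj ?G)"
    then show "u \<rightarrow>\<^sup>*\<^bsub>with_proj ?G\<^esub> v"
      using base[of u] base[of v] pair_sym_arcs
      by (metis reachable_trans symmetric_reachable with_proj_simps(1))
  qed
  then show ?thesis
    using reachable_mk_symmetricI by (auto simp: connected_def strongly_connected_def)
qed

end

theory Submission
  imports Defs
begin

text \<open>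
  The dimension cannot be below two for a parity reason.  In a connected graph the distances of two
  adjacent vertices to a landmark \<open>s\<close> differ by at most one, so if \<open>s\<close> alone separates all adjacent
  vertices, then they differ by exactly one and the parity of the distance to \<open>s\<close> is a proper
  2-colouring (\<open>two_colouring_of_single_landmark\<close>).  Each layer over a vertex of \<open>U\<close> is a copy of
  the odd cycle, which has no such colouring.

  Two landmarks suffice: take \<open>(1, 0)\<close> and \<open>(1, 1)\<close>, neighbours in the layer at one end of the
  path.  As the end vertex \<open>1\<close> lies in \<open>U\<close>, no detour is ever needed to change the cycle coordinate
  on the way there, and the distance from \<open>(i, h)\<close> to \<open>(1, c)\<close> is the sum of the distance
  \<open>i - 1\<close> in the path and the distance from \<open>h\<close> to \<open>c\<close> in the cycle (\<open>graph_dist_Gamma_first\<close>).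
  Path edges are therefore separated by either landmark.  A cycle edge is missed by \<open>(1, c)\<close> only if
  its two ends are equally far from \<open>c\<close> in the cycle, that is, if it is the edge opposite to \<open>c\<close>;
  the edges opposite to \<open>0\<close> and to \<open>1\<close> are different (\<open>cycle_dist_separates\<close>).
\<close>

section \<open>Distances in finite graphs\<close>

lemma (in wf_digraph) awalk_cost_unit: "awalk_cost (\<lambda>_. 1) p = real (length p)"
  by (induction p) auto

lemma (in wf_digraph) graph_dist_le_length:
  assumes "awalk u p v"
  shows "graph_dist G u v \<le> ereal (real (length p))"
  using min_cost_le_walk_cost[OF assms, of "\<lambda>_. 1"]
  by (simp add: graph_dist_def awalk_cost_unit)

lemma (in fin_digraph) obtain_shortest_awalk:
  assumes "u \<rightarrow>\<^sup>* v"
  obtains p where "awalk u p v" "graph_dist G u v = ereal (real (length p))"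
  using min_cost_awalk[OF assms, of "\<lambda>_. 1"]
  by (auto simp: graph_dist_def awalk_cost_unit apath_def)

lemma (in wf_digraph) adj_awalk_Cons:
  assumes "u \<rightarrow>\<^bsub>G\<^esub> v" "awalk v p w"
  obtains e where "awalk u (e # p) w"
  using assms by (auto simp: awalk_Cons_iff arcs_ends_conv)

text \<open>
  A potential that drops by at most one along each arc bounds every walk to \<open>s\<close> from below, and
  following arcs on which it drops by one yields a walk attaining the bound.
\<close>

lemma (in wf_digraph) graph_dist_eq_potential:
  fixes f :: "'a \<Rightarrow> nat"
  assumes "f s = 0"
    and lip: "\<And>u v. u \<rightarrow>\<^bsub>G\<^esub> v \<Longrightarrow> f u \<le> Suc (f v)"
    and descent: "\<And>u. u \<in> verts G \<Longrightarrow> u \<noteq> s \<Longrightarrow> \<exists>v. u \<rightarrow>\<^bsub>G\<^esub> v \<and> f u = Suc (f v)"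
    and "u \<in> verts G"
  shows "graph_dist G u s = ereal (real (f u))"
proof (rule antisym)
  have "f u \<le> length p" if "awalk u p s" for p
    using that
  proof (induction p arbitrary: u)
    case Nil
    then show ?case using \<open>f s = 0\<close> by (auto simp: awalk_Nil_iff)
  next
    case (Cons e p)
    then have "u \<rightarrow>\<^bsub>G\<^esub> head G e" "f (head G e) \<le> length p"
      by (auto simp: awalk_Cons_iff intro: in_arcs_imp_in_arcs_ends)
    with lip[of u "head G e"] show ?case by simp
  qed
  then show "ereal (real (f u)) \<le> graph_dist G u s"
    unfolding graph_dist_def \<mu>_def by (auto simp: awalk_cost_unit intro: INF_greatest)
  have "\<exists>p. awalk u p s \<and> length p = f u"
    using \<open>u \<in> verts G\<close>
  proof (induction "f u" arbitrary: u)
    case 0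
    then have "u = s" using descent by fastforce
    then show ?case using 0 by (auto simp: awalk_Nil_iff intro: exI[of _ "[]"])
  next
    case (Suc m)
    then obtain v where v: "u \<rightarrow>\<^bsub>G\<^esub> v" "f u = Suc (f v)"
      using \<open>f s = 0\<close> descent by (metis nat.distinct(1))
    then obtain p where "awalk v p s" "length p = f v"
      using Suc by (metis adj_in_verts(2) nat.inject)
    with v show ?case by (metis adj_awalk_Cons length_Cons)
  qed
  then show "graph_dist G u s \<le> ereal (real (f u))"
    using graph_dist_le_length by metis
qed

section \<open>A single landmark forces a proper 2-colouring\<close>

lemma metric_repr_eq_iff:
  "metric_repr G S u = metric_repr G S v \<longleftrightarrow> (\<forall>s\<in>S. graph_dist G u s = graph_dist G v s)"
  unfolding metric_repr_def by (auto simp: restrict_def fun_eq_iff)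

text \<open>The colour of a vertex is the parity of its distance to the landmark.\<close>

lemma (in pseudo_graph) two_colouring_of_single_landmark:
  assumes conn: "strongly_connected G" and "s \<in> verts G"
    and gen: "local_metric_generator G S" and "S \<subseteq> {s}"
  obtains c :: "'a \<Rightarrow> bool" where "\<And>u v. u \<rightarrow>\<^bsub>G\<^esub> v \<Longrightarrow> c u \<noteq> c v"
proof -
  have "\<exists>m::nat. graph_dist G u s = ereal (real m)" if "u \<in> verts G" for u
    using that conn \<open>s \<in> verts G\<close> obtain_shortest_awalk[of u s]
    by (metis strongly_connectedE)
  then obtain d :: "'a \<Rightarrow> nat" where
    d: "\<And>u. u \<in> verts G \<Longrightarrow> graph_dist G u s = ereal (real (d u))"
    by metis
  have step: "d u \<le> Suc (d v)" if "u \<rightarrow>\<^bsub>G\<^esub> v" for u v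
  proof -
    have V: "u \<in> verts G" "v \<in> verts G" using that by (auto simp: adj_in_verts)
    with conn \<open>s \<in> verts G\<close> obtain p where
      p: "awalk v p s" "graph_dist G v s = ereal (real (length p))"
      by (metis obtain_shortest_awalk strongly_connectedE)
    then obtain e where "awalk u (e # p) s" using adj_awalk_Cons \<open>u \<rightarrow>\<^bsub>G\<^esub> v\<close> by blast
    from graph_dist_le_length[OF this] show ?thesis using d V p by simp
  qed
  have "even (d u) \<noteq> even (d v)" if "u \<rightarrow>\<^bsub>G\<^esub> v" for u v
  proof -
    have "u \<in> verts G" "v \<in> verts G" using that by (auto simp: adj_in_verts)
    moreover have "graph_dist G u s \<noteq> graph_dist G v s"
      using gen that \<open>S \<subseteq> {s}\<close> unfolding local_metric_generator_def metric_repr_eq_iff by blast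
    ultimately have "d u \<noteq> d v" using d by auto
    moreover have "v \<rightarrow>\<^bsub>G\<^esub> u" using that sym_arcs by (auto simp: symmetric_def dest: symD)
    ultimately have "d u = Suc (d v) \<or> d v = Suc (d u)"
      using step[OF that] step[of v u] by linarith
    then show ?thesis by auto
  qed
  then show thesis using that[of "\<lambda>u. even (d u)"] by blast
qed

section \<open>Distances in a cycle\<close>

definition cycle_dist :: "nat \<Rightarrow> nat \<Rightarrow> nat \<Rightarrow> nat" where
  "cycle_dist k a c = min (max a c - min a c) (k - (max a c - min a c))"

lemma parcs_cycle_graph_iff:
  "(a, b) \<in> parcs (cycle_graph k) \<longleftrightarrow>
     a < k \<and> b < k \<and> (b = Suc a \<or> a = Suc b \<or> Suc a = k \<and> b = 0 \<or> a = 0 \<and> Suc b = k)"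
  by (auto simp: cycle_graph_def mod_Suc split: if_splits)

lemma cycle_dist_lipschitz:
  assumes "(a, b) \<in> parcs (cycle_graph k)" "c < k"
  shows "cycle_dist k a c \<le> Suc (cycle_dist k b c)"
  using assms unfolding parcs_cycle_graph_iff cycle_dist_def by (auto simp: min_def max_def)

lemma cycle_dist_descent:
  assumes "a < k" "c < k" "a \<noteq> c"
  obtains b where "(a, b) \<in> parcs (cycle_graph k)" "cycle_dist k a c = Suc (cycle_dist k b c)"
proof -
  consider "a < c" "2 * (c - a) \<le> k" | "a < c" "2 * (c - a) > k"
    | "c < a" "2 * (a - c) \<le> k" | "c < a" "2 * (a - c) > k"
    using \<open>a \<noteq> c\<close> by linarith
  then show thesis
  proof cases
    case 1
    then show thesis
      using assms by (intro that[of "Suc a"]) (auto simp: parcs_cycle_graph_iff cycle_dist_def)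
  next
    case 2
    \<comment> \<open>The shorter way to \<open>c\<close> goes down, through the edge between \<open>0\<close> and \<open>k - 1\<close>.\<close>
    show thesis
    proof (cases "a = 0")
      case True
      with 2 assms have "(a, k - 1) \<in> parcs (cycle_graph k)"
          "cycle_dist k a c = Suc (cycle_dist k (k - 1) c)"
        by (auto simp: parcs_cycle_graph_iff cycle_dist_def min_def max_def)
      then show thesis by (rule that)
    next
      case False
      with 2 assms have "(a, a - 1) \<in> parcs (cycle_graph k)"
          "cycle_dist k a c = Suc (cycle_dist k (a - 1) c)"
        by (auto simp: parcs_cycle_graph_iff cycle_dist_def min_def max_def)
      then show thesis by (rule that)
    qed
  next
    case 3
    then show thesis
      using assms by (intro that[of "a - 1"]) (auto simp: parcs_cycle_graph_iff cycle_dist_def)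
  next
    case 4
    \<comment> \<open>The shorter way to \<open>c\<close> goes up, through the edge between \<open>k - 1\<close> and \<open>0\<close>.\<close>
    show thesis
    proof (cases "Suc a = k")
      case True
      with 4 assms have "(a, 0) \<in> parcs (cycle_graph k)"
          "cycle_dist k a c = Suc (cycle_dist k 0 c)"
        by (auto simp: parcs_cycle_graph_iff cycle_dist_def min_def max_def)
      then show thesis by (rule that)
    next
      case False
      with 4 assms have "(a, Suc a) \<in> parcs (cycle_graph k)"
          "cycle_dist k a c = Suc (cycle_dist k (Suc a) c)"
        by (auto simp: parcs_cycle_graph_iff cycle_dist_def min_def max_def)
      then show thesis by (rule that)
    qed
  qed
qed

text \<open>
  The two ends of an edge have the same distance to \<open>0\<close> only if they are \<open>(k - 1) div 2\<close> and
  \<open>(k + 1) div 2\<close>, whose distances to \<open>1\<close> differ.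
\<close>

lemma cycle_dist_separates:
  assumes "(a, b) \<in> parcs (cycle_graph k)" "k \<ge> 3"
  shows "cycle_dist k a 0 \<noteq> cycle_dist k b 0 \<or> cycle_dist k a 1 \<noteq> cycle_dist k b 1"
proof -
  have to0: "cycle_dist k x 0 = min x (k - x)" for x
    by (simp add: cycle_dist_def)
  have to1: "cycle_dist k (Suc x) 1 = min x (k - x)" for x
    by (simp add: cycle_dist_def)
  have up: "cycle_dist k x 0 \<noteq> cycle_dist k (Suc x) 0
      \<or> cycle_dist k x 1 \<noteq> cycle_dist k (Suc x) 1"
    if "Suc x < k" for x
  proof (cases x)
    case 0
    then show ?thesis using that by (simp add: to0)
  next
    case (Suc y)
    have "min x (k - x) = min y (k - y) \<Longrightarrow> min x (k - x) \<noteq> min (Suc x) (k - Suc x)"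
      using that Suc by linarith
    then show ?thesis using Suc by (metis to0 to1)
  qed
  have wrap: "cycle_dist k (k - 1) 0 \<noteq> cycle_dist k 0 0"
    using \<open>k \<ge> 3\<close> by (simp add: to0)
  from assms(1) consider "b = Suc a" "b < k" | "a = Suc b" "a < k"
    | "a = k - 1" "b = 0" | "a = 0" "b = k - 1"
    unfolding parcs_cycle_graph_iff by force
  then show ?thesis
    using up[of a] up[of b] wrap by cases metis+
qed

section \<open>The product of the path and the cycle\<close>

lemma pverts_Gamma_graph_iff:
  "(i, h) \<in> pverts (Gamma_graph n k) \<longleftrightarrow> 1 \<le> i \<and> i \<le> 2 * n + 1 \<and> h < k"
  by (auto simp: Gamma_graph_def hierarchical_product_def path_graph_def cycle_graph_def)

lemma parcs_Gamma_graph_iff: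
  "((i, h), (i', h')) \<in> parcs (Gamma_graph n k) \<longleftrightarrow>
     i \<in> {1..2 * n + 1} \<and> i' \<in> {1..2 * n + 1} \<and> (i' = Suc i \<or> i = Suc i') \<and> h = h' \<and> h < k
   \<or> i = i' \<and> i \<le> 2 * n + 1 \<and> odd i \<and> (h, h') \<in> parcs (cycle_graph k)"
  by (auto simp: Gamma_graph_def hierarchical_product_def path_graph_def cycle_graph_def
      elim!: oddE)

text \<open>
  From any other vertex the distance to \<open>(1, c)\<close> decreases by moving down the path as long as this is
  possible; the remaining distance is covered within the layer over \<open>1 \<in> U\<close>.
\<close>

lemma graph_dist_Gamma_first:
  assumes "k \<ge> 2" "c < k" "(i, h) \<in> pverts (Gamma_graph n k)"
  shows "graph_dist (with_proj (Gamma_graph n k)) (i, h) (1, c)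
    = ereal (real (i - 1 + cycle_dist k h c))"
proof -
  let ?G = "Gamma_graph n k"
  let ?f = "\<lambda>(i, h). i - 1 + cycle_dist k h c"
  interpret pair_graph ?G by (rule pair_graph_Gamma_graph[OF \<open>k \<ge> 2\<close>])
  have "graph_dist (with_proj ?G) (i, h) (1, c) = ereal (real (?f (i, h)))"
  proof (rule graph_dist_eq_potential)
    show "?f (1, c) = 0" by (simp add: cycle_dist_def)
  next
    fix u v assume "(u, v) \<in> parcs ?G"
    then show "?f u \<le> Suc (?f v)"
      using cycle_dist_lipschitz[OF _ \<open>c < k\<close>, of "snd u" "snd v"]
      by (cases u; cases v) (auto simp: parcs_Gamma_graph_iff)
  next
    fix u assume u: "u \<in> pverts ?G" "u \<noteq> (1, c)"
    obtain j a where ja: "u = (j, a)" by (cases u)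
    with u have V: "1 \<le> j" "j \<le> 2 * n + 1" "a < k" by (auto simp: pverts_Gamma_graph_iff)
    show "\<exists>v. (u, v) \<in> parcs ?G \<and> ?f u = Suc (?f v)"
    proof (cases "j = 1")
      case True
      then obtain b where "(a, b) \<in> parcs (cycle_graph k)"
          "cycle_dist k a c = Suc (cycle_dist k b c)"
        using cycle_dist_descent[of a k c] u V ja \<open>c < k\<close> by auto
      then have "((j, a), (1, b)) \<in> parcs ?G \<and> ?f (j, a) = Suc (?f (1, b))"
        using True by (auto simp: parcs_Gamma_graph_iff)
      then show ?thesis using ja by blast
    next
      case False
      then have "((j, a), (j - 1, a)) \<in> parcs ?G \<and> ?f (j, a) = Suc (?f (j - 1, a))"
        using V by (auto simp: parcs_Gamma_graph_iff)
      then show ?thesis using ja by blast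
    qed
  qed (fact assms(3))
  then show ?thesis by simp
qed

lemma two_landmarks_generate_Gamma:
  assumes "k \<ge> 3"
  shows "local_metric_generator (with_proj (Gamma_graph n k)) {(1, 0), (1, 1)}"
proof -
  let ?G = "Gamma_graph n k"
  interpret pair_graph ?G by (rule pair_graph_Gamma_graph) (use assms in simp)
  have "metric_repr ?G {(1, 0), (1, 1)} u \<noteq> metric_repr ?G {(1, 0), (1, 1)} v"
    if "(u, v) \<in> parcs ?G" for u v
  proof -
    obtain i h j l where uv: "u = (i, h)" "v = (j, l)" by (cases u, cases v)
    have V: "(i, h) \<in> pverts ?G" "(j, l) \<in> pverts ?G"
      using that uv by (auto dest: wellformed')
    then have "1 \<le> i" "1 \<le> j" by (auto simp: pverts_Gamma_graph_iff)
    then have "i - 1 + cycle_dist k h 0 \<noteq> j - 1 + cycle_dist k l 0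
        \<or> i - 1 + cycle_dist k h 1 \<noteq> j - 1 + cycle_dist k l 1"
      using that uv cycle_dist_separates[OF _ assms, of h l]
      by (auto simp: parcs_Gamma_graph_iff)
    then show ?thesis
      using assms V graph_dist_Gamma_first[of k 0] graph_dist_Gamma_first[of k 1]
      by (simp add: uv metric_repr_eq_iff flip: of_nat_add)
  qed
  then show ?thesis
    using assms by (auto simp: local_metric_generator_def pverts_Gamma_graph_iff)
qed

text \<open>Along the cycle over \<open>1 \<in> U\<close> the colours alternate, and an odd cycle cannot close up.\<close>

lemma Gamma_graph_not_two_colourable:
  fixes c :: "nat \<times> nat \<Rightarrow> bool"
  assumes "odd k" "k \<ge> 3"
  shows "\<exists>u v. (u, v) \<in> parcs (Gamma_graph n k) \<and> c u = c v"
proof (rule ccontr)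
  assume no_monochromatic_edge: "\<not> ?thesis"
  have proper: "c (1, a) \<noteq> c (1, b)" if "(a, b) \<in> parcs (cycle_graph k)" for a b
  proof -
    have "((1, a), (1, b)) \<in> parcs (Gamma_graph n k)"
      using that by (simp add: parcs_Gamma_graph_iff)
    with no_monochromatic_edge show ?thesis by blast
  qed
  have alternate: "c (1, h) = (c (1, 0) = even h)" if "h < k" for h
    using that
  proof (induction h)
    case (Suc h)
    then show ?case using proper[of h "Suc h"] by (auto simp: parcs_cycle_graph_iff)
  qed simp
  have "c (1, k - 1) \<noteq> c (1, 0)"
    using assms by (intro proper) (auto simp: parcs_cycle_graph_iff)
  moreover have "c (1, k - 1) = c (1, 0)" using alternate[of "k - 1"] assms by auto
  ultimately show False by simp
qed

lemma card_generator_Gamma_ge_2: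
  assumes "odd k" "k \<ge> 3" and gen: "local_metric_generator (with_proj (Gamma_graph n k)) S"
  shows "card S \<ge> 2"
proof (rule ccontr)
  let ?G = "Gamma_graph n k"
  interpret pair_graph ?G by (rule pair_graph_Gamma_graph) (use assms in simp)
  assume "\<not> card S \<ge> 2"
  have S: "finite S" "S \<subseteq> pverts ?G"
    using gen by (auto simp: local_metric_generator_def)
  \<comment> \<open>The case \<open>S = {}\<close> is treated together with that of a singleton, by choosing any landmark.\<close>
  obtain s where s: "s \<in> pverts ?G" "S \<subseteq> {s}"
  proof (cases "S = {}")
    case True
    moreover have "(1, 0) \<in> pverts ?G" using assms by (simp add: pverts_Gamma_graph_iff)
    ultimately show thesis using that by blast
  next
    case False
    then have "card S = 1" using \<open>\<not> card S \<ge> 2\<close> S card_gt_0_iff[of S] by linarith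
    then show thesis using that S by (metis card_1_singletonE insert_subset subset_refl)
  qed
  have "strongly_connected ?G"
    using pair_sym_arcs connected_Gamma_graph[of k n] assms
    by (intro symmetric_connected_imp_strongly_connected) auto
  then obtain c :: "nat \<times> nat \<Rightarrow> bool" where "\<And>u v. (u, v) \<in> parcs ?G \<Longrightarrow> c u \<noteq> c v"
    using two_colouring_of_single_landmark[OF _ _ gen] s by metis
  then show False using Gamma_graph_not_two_colourable[OF assms(1,2)] by blast
qed

theorem proposition3p1:
  fixes n k :: nat
  assumes "n \<ge> 1"
    and "k \<ge> 3"
    and "odd k"
  shows "local_metric_dim (with_proj (Gamma_graph n k)) = 2"
  unfolding local_metric_dim_def
proof (rule Least_equality)
  show "\<exists>S. local_metric_generator (with_proj (Gamma_graph n k)) S \<and> card S = 2"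
    using two_landmarks_generate_Gamma[OF assms(2)] by (intro exI conjI) auto
qed (use card_generator_Gamma_ge_2[OF assms(3,2)] in auto)

end
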